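(* Consider a partially observed linear causal model with $m\ge 1$ latent variables and parameters $\theta=(F_{\mathbf L\mathbf L},F_{\mathbf L\mathbf X},F_{\mathbf X\mathbf L},F_{\mathbf X\mathbf X},\Omega_{\epsilon_{\mathbf L}},\Omega_{\epsilon_{\mathbf X}})$ with $\Omega_{\epsilon_{\mathbf L}}=I$. Let $S$ be an $m\times m$ diagonal sign matrix (each diagonal entry is $1$ or $-1$), and let $\tilde\theta=(\tilde F_{\mathbf L\mathbf L},\tilde F_{\mathbf L\mathbf X},\tilde F_{\mathbf X\mathbf L},\tilde F_{\mathbf X\mathbf X},\tilde\Omega_{\epsilon_{\mathbf L}},\tilde\Omega_{\epsilon_{\mathbf X}})$, where $$\tilde F_{\mathbf L\mathbf L}=SF_{\mathbf L\mathbf L}S,\quad \tilde F_{\mathbf L\mathbf X}=SF_{\mathbf L\mathbf X},\quad \tilde F_{\mathbf X\mathbf L}=F_{\mathbf X\mathbf L}S,\quad \tilde F_{\mathbf X\mathbf X}=F_{\mathbf X\mathbf X},\quad \tilde\Omega_{\epsilon_{\mathbf L}}=\Omega_{\epsilon_{\mathbf L}}=I,\quad \tilde\Omega_{\epsilon_{\mathbf X}}=\Omega_{\epsilon_{\mathbf X}}.$$ Then $\tilde\theta$ and $\theta$ entail the same observations, i.e. $\tilde\Sigma_{\mathbf X}=\Sigma_{\mathbf X}$, and $(\tilde\Sigma_{\mathbf L})_{ii}=(\Sigma_{\mathbf L})_{ii}$ for all $i\in\{1,\dots,m\}$.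
   Context: Partially observed linear causal model: Let $\mathcal G$ be a DAG on $m+n$ variables $\mathbf V=\mathbf L\cup\mathbf X$, with $m$ latent variables $\mathbf L=\{L_1,\dots,L_m\}$ and $n$ observed variables $\mathbf X$. Each variable satisfies $V_i=\sum_{V_j\in \mathrm{Pa}_{\mathcal G}(V_i)} f_{j,i}V_j+\epsilon_{V_i}$ with independent Gaussian noise terms; in matrix form $\mathbf V=F^T\mathbf V+\epsilon_{\mathbf V}$, where $F=(f_{j,i})$ and $f_{j,i}\ne 0$ if and only if $V_j$ is a parent of $V_i$ in $\mathcal G$. Write, with latent variables ordered first, $$F=\begin{pmatrix} F_{\mathbf L\mathbf L} & F_{\mathbf L\mathbf X} \\ F_{\mathbf X\mathbf L} & F_{\mathbf X\mathbf X} \end{pmatrix},\qquad \Omega=\begin{pmatrix} \Omega_{\epsilon_{\mathbf L}} & 0 \\ 0 & \Omega_{\epsilon_{\mathbf X}} \end{pmatrix},$$ where $\Omega$ is the diagonal covariance matrix of $\epsilon_{\mathbf V}$. The covariance matrix of $\mathbf V$ entailed by $(F,\Omega)$ is $(I-F)^{-T}\Omega(I-F)^{-1}$; $\Sigma_{\mathbf L}$ and $\Sigma_{\mathbf X}$ denote its principal blocks for $\mathbf L$ and $\mathbf X$. $\tilde\Sigma_{\mathbf L},\tilde\Sigma_{\mathbf X}$ denote the corresponding matrices entailed by $\tilde\theta$. *)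

theory Defs
  imports
    "Jordan_Normal_Form.Matrix"
    "Jordan_Normal_Form.Gauss_Jordan_Elimination"
begin

text \<open>
  The variables are the indices \<open>{..<m + n}\<close>: the latent variables are \<open>0, ..., m - 1\<close> and the
  observed ones are \<open>m, ..., m + n - 1\<close>. A graph on them is a set of edges, where
  \<open>(j, i) \<in> G\<close> means that \<open>j\<close> is a parent of \<open>i\<close>.
\<close>

definition dag :: "nat \<Rightarrow> (nat \<times> nat) set \<Rightarrow> bool" where
  "dag N G \<longleftrightarrow> G \<subseteq> {..<N} \<times> {..<N} \<and> acyclic G"

record params =
  F_LL :: "real mat"
  F_LX :: "real mat"
  F_XL :: "real mat"
  F_XX :: "real mat"
  Omega_L :: "real mat"
  Omega_X :: "real mat"

definition coeff_mat :: "params \<Rightarrow> real mat" where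
  "coeff_mat \<theta> = four_block_mat (F_LL \<theta>) (F_LX \<theta>) (F_XL \<theta>) (F_XX \<theta>)"

definition noise_cov :: "nat \<Rightarrow> nat \<Rightarrow> params \<Rightarrow> real mat" where
  "noise_cov m n \<theta> = four_block_mat (Omega_L \<theta>) (0\<^sub>m m n) (0\<^sub>m n m) (Omega_X \<theta>)"

text \<open>
  Entry \<open>(j, i)\<close> of the coefficient matrix is the coefficient of variable \<open>j\<close> in the structural
  equation of variable \<open>i\<close>. The diagonal entries of the noise covariance are the variances of
  the noise terms; they may vanish, so that degenerate Gaussian noise is included.
\<close>

definition linear_causal_model :: "nat \<Rightarrow> nat \<Rightarrow> (nat \<times> nat) set \<Rightarrow> params \<Rightarrow> bool" where
  "linear_causal_model m n G \<theta> \<longleftrightarrow>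
     dag (m + n) G \<and>
     F_LL \<theta> \<in> carrier_mat m m \<and> F_LX \<theta> \<in> carrier_mat m n \<and>
     F_XL \<theta> \<in> carrier_mat n m \<and> F_XX \<theta> \<in> carrier_mat n n \<and>
     Omega_L \<theta> \<in> carrier_mat m m \<and> Omega_X \<theta> \<in> carrier_mat n n \<and>
     (\<forall>j<m + n. \<forall>i<m + n. coeff_mat \<theta> $$ (j, i) \<noteq> 0 \<longleftrightarrow> (j, i) \<in> G) \<and>
     diagonal_mat (noise_cov m n \<theta>) \<and>
     (\<forall>i<m + n. 0 \<le> noise_cov m n \<theta> $$ (i, i))"

text \<open>
  Solving \<open>V = F\<^sup>T V + \<epsilon>\<close> gives \<open>V = ((I - F)\<^sup>T)\<^sup>-\<^sup>1 \<epsilon>\<close>, where \<open>F\<close> is the coefficient matrix. The inverse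
  exists because the graph is acyclic, which makes \<open>F\<close> nilpotent.
\<close>

definition entailed_cov :: "nat \<Rightarrow> nat \<Rightarrow> params \<Rightarrow> real mat" where
  "entailed_cov m n \<theta> =
     (let B = the (mat_inverse (1\<^sub>m (m + n) - coeff_mat \<theta>))
      in B\<^sup>T * noise_cov m n \<theta> * B)"

definition Sigma_L :: "nat \<Rightarrow> nat \<Rightarrow> params \<Rightarrow> real mat" where
  "Sigma_L m n \<theta> = mat m m (\<lambda>(i, j). entailed_cov m n \<theta> $$ (i, j))"

definition Sigma_X :: "nat \<Rightarrow> nat \<Rightarrow> params \<Rightarrow> real mat" where
  "Sigma_X m n \<theta> = mat n n (\<lambda>(i, j). entailed_cov m n \<theta> $$ (m + i, m + j))"

definition sign_mat :: "nat \<Rightarrow> real mat \<Rightarrow> bool" where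
  "sign_mat m S \<longleftrightarrow>
     S \<in> carrier_mat m m \<and> diagonal_mat S \<and> (\<forall>i<m. S $$ (i, i) = 1 \<or> S $$ (i, i) = - 1)"

end

theory Submission
  imports Defs
begin

text \<open>
  With \<open>D = diag(S, I)\<close> one has \<open>D\<^sup>2 = I\<close> and \<open>I - F' = D (I - F) D\<close>, so the inverse of \<open>I - F\<close> is
  conjugated by \<open>D\<close> as well. The diagonal noise covariance commutes with \<open>D\<close>; hence the entailed
  covariance is conjugated by \<open>D\<close>, which only multiplies its \<open>(i, j)\<close> entry by the product of the
  signs of \<open>i\<close> and \<open>j\<close>.
\<close>

text \<open>A two-sided inverse makes \<open>A\<close> a unit, which excludes \<open>None\<close>;
  uniqueness of inverses then identifies the computed value with \<open>B\<close>.\<close>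

lemma mat_inverse_SomeI:
  fixes A :: "'a::field mat"
  assumes A: "A \<in> carrier_mat n n" and B: "B \<in> carrier_mat n n"
    and AB: "A * B = 1\<^sub>m n" and BA: "B * A = 1\<^sub>m n"
  shows "mat_inverse A = Some B"
proof (cases "mat_inverse A")
  case None
  \<comment> \<open>The last argument of \<open>ring_mat\<close> only fills the extension slot of
    the ring record, so any value serves.\<close>
  have "A \<in> Units (ring_mat TYPE('a) n undefined)"
    using A B AB BA unfolding Units_def ring_mat_def by auto
  with mat_inverse(1)[OF A None, of undefined] show ?thesis by blast
next
  case (Some C)
  with mat_inverse(2)[OF A Some] have C: "C \<in> carrier_mat n n" and CA: "C * A = 1\<^sub>m n"
    by auto
  have "C = C * (A * B)" using AB C by simp
  also have "\<dots> = (C * A) * B" using A B C by (simp add: assoc_mult_mat)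
  also have "\<dots> = B" using CA B by simp
  finally show ?thesis using Some by simp
qed

text \<open>The two inner factors \<open>D\<close> meet and cancel, so conjugation by an involution
  is multiplicative.\<close>

lemma involution_conj_mult:
  fixes D :: "'a::semiring_1 mat"
  assumes D: "D \<in> carrier_mat n n" and DD: "D * D = 1\<^sub>m n"
    and A: "A \<in> carrier_mat n n" and B: "B \<in> carrier_mat n n"
  shows "(D * A * D) * (D * B * D) = D * (A * B) * D"
proof -
  have "(D * A * D) * (D * B * D) = (D * A) * ((D * D) * (B * D))"
    using D A B by (simp add: assoc_mult_mat[of _ n n _ n _ n])
  also have "\<dots> = D * (A * B) * D"
    unfolding DD using D A B by (simp add: assoc_mult_mat[of _ n n _ n _ n])
  finally show ?thesis .
qed

text \<open>Conjugation preserves products and the identity, hence inverses. The equation between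
  options also covers singular \<open>A\<close>.\<close>

lemma mat_inverse_involution_conj:
  fixes A :: "'a::field mat"
  assumes D: "D \<in> carrier_mat n n" and DD: "D * D = 1\<^sub>m n" and A: "A \<in> carrier_mat n n"
  shows "mat_inverse (D * A * D) = map_option (\<lambda>B. D * B * D) (mat_inverse A)"
proof -
  have Some_conj: "mat_inverse (D * M * D) = Some (D * B * D)"
    if M: "M \<in> carrier_mat n n" and inv: "mat_inverse M = Some B" for M B
  proof -
    from mat_inverse(2)[OF M inv]
    have B: "B \<in> carrier_mat n n" and MB: "M * B = 1\<^sub>m n" and BM: "B * M = 1\<^sub>m n"
      by auto
    have "(D * M * D) * (D * B * D) = 1\<^sub>m n" "(D * B * D) * (D * M * D) = 1\<^sub>m n"
      unfolding involution_conj_mult[OF D DD M B] involution_conj_mult[OF D DD B M] MB BM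
      using D DD by auto
    then show ?thesis
      using D M B by (intro mat_inverse_SomeI[where n = n]) auto
  qed
  show ?thesis
  proof (cases "mat_inverse A")
    case None
    \<comment> \<open>Conjugating twice gives back \<open>A\<close>, so by \<open>Some_conj\<close>
      an inverse of \<open>D * A * D\<close> would yield one of \<open>A\<close>.\<close>
    have "D * (D * A * D) * D = (D * D) * A * (D * D)"
      using D A by (simp add: assoc_mult_mat[of _ n n _ n _ n])
    also have "\<dots> = A" using A DD by simp
    finally have "D * (D * A * D) * D = A" .
    moreover have "D * A * D \<in> carrier_mat n n" using D A by simp
    ultimately have "mat_inverse (D * A * D) = None"
      using Some_conj[of "D * A * D"] None by (cases "mat_inverse (D * A * D)") auto
    with None show ?thesis by simp
  qed (simp add: Some_conj[OF A])
qed

lemma mat_diag_conj_index: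
  fixes M :: "'a::semiring_1 mat"
  assumes "M \<in> carrier_mat N N" and "i < N" "j < N"
  shows "(mat_diag N d * M * mat_diag N d) $$ (i, j) = d i * M $$ (i, j) * d j"
  using assms by (simp add: mat_diag_mult_left[of _ N N] mat_diag_mult_right[of _ N N])

lemma sign_mat_eq_mat_diag:
  assumes "sign_mat m S"
  shows "S = mat_diag m (\<lambda>i. S $$ (i, i))"
  using assms unfolding sign_mat_def diagonal_mat_def mat_diag_def
  by (intro eq_matI) auto

theorem theorem2:
  fixes m n :: nat and G :: "(nat \<times> nat) set" and \<theta> \<theta>' :: params and S :: "real mat"
  assumes "m \<ge> 1"
    and "linear_causal_model m n G \<theta>"
    and "Omega_L \<theta> = 1\<^sub>m m"
    and "sign_mat m S"
    and "\<theta>' = \<lparr>F_LL = S * F_LL \<theta> * S, F_LX = S * F_LX \<theta>, F_XL = F_XL \<theta> * S, F_XX = F_XX \<theta>,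
               Omega_L = Omega_L \<theta>, Omega_X = Omega_X \<theta>\<rparr>"
  shows "Sigma_X m n \<theta>' = Sigma_X m n \<theta> \<and>
         (\<forall>i<m. Sigma_L m n \<theta>' $$ (i, i) = Sigma_L m n \<theta> $$ (i, i))"
proof -
  define N where "N = m + n"
  \<comment> \<open>The signs of \<open>S\<close> on the latent indices, continued by 1 on the
    observed ones.\<close>
  define d where "d i = (if i < m then S $$ (i, i) else 1)" for i
  define D where "D = mat_diag N d"
  define F where "F = coeff_mat \<theta>"
  define W where "W = noise_cov m n \<theta>"
  note model = assms(2)[unfolded linear_causal_model_def]
  have blocks: "F_LL \<theta> \<in> carrier_mat m m" "F_LX \<theta> \<in> carrier_mat m n"
    "F_XL \<theta> \<in> carrier_mat n m" "F_XX \<theta> \<in> carrier_mat n n"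
    using model by auto
  have F: "F \<in> carrier_mat N N"
    using blocks by (simp add: F_def coeff_mat_def N_def)
  have W: "W \<in> carrier_mat N N"
    using model by (simp add: W_def noise_cov_def N_def)
  have D: "D \<in> carrier_mat N N" by (simp add: D_def)
  have dd: "d i * d i = 1" for i
    using assms(4) by (auto simp: d_def sign_mat_def)
  have DD: "D * D = 1\<^sub>m N" by (simp add: D_def dd)
  have DT: "D\<^sup>T = D" by (auto simp: D_def mat_diag_def)
  \<comment> \<open>Writing \<open>S\<close> with the same function \<open>d\<close> as
    \<open>D\<close> lets the four blocks be compared with \<open>D * F * D\<close> entry by
    entry.\<close>
  have S: "S = mat_diag m d"
    by (subst sign_mat_eq_mat_diag[OF assms(4)], rule eq_matI) (auto simp: d_def mat_diag_def)
  have F': "coeff_mat \<theta>' = D * F * D"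
  proof (rule eq_matI)
    fix i j assume ij: "i < dim_row (D * F * D)" "j < dim_col (D * F * D)"
    then have "i < N" "j < N" using D by auto
    moreover have "d k = 1" if "\<not> k < m" for k using that by (simp add: d_def)
    ultimately show "coeff_mat \<theta>' $$ (i, j) = (D * F * D) $$ (i, j)"
      unfolding D_def mat_diag_conj_index[OF F \<open>i < N\<close> \<open>j < N\<close>]
      using blocks
      by (simp add: assms(5) coeff_mat_def F_def S N_def mat_diag_mult_left[of _ m]
          mat_diag_mult_right[of _ m m] mat_diag_mult_right[of _ n m])
  qed (use blocks D in \<open>auto simp: assms(5) coeff_mat_def S N_def mat_diag_def\<close>)
  \<comment> \<open>The identity survives conjugation because its diagonal entries become
    \<open>d j * d j = 1\<close>.\<close>
  have "1\<^sub>m N - D * F * D = D * (1\<^sub>m N - F) * D"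
  proof (rule eq_matI)
    fix i j assume "i < dim_row (D * (1\<^sub>m N - F) * D)" "j < dim_col (D * (1\<^sub>m N - F) * D)"
    then have "i < N" "j < N" using D by auto
    then show "(1\<^sub>m N - D * F * D) $$ (i, j) = (D * (1\<^sub>m N - F) * D) $$ (i, j)"
      using F D dd[of j] mat_diag_conj_index[OF F, of i j d]
        mat_diag_conj_index[OF minus_carrier_mat[OF F], of i j d "1\<^sub>m N"]
      by (auto simp: algebra_simps simp flip: D_def)
  qed (use D F in auto)
  then have inv': "mat_inverse (1\<^sub>m N - coeff_mat \<theta>') =
      map_option (\<lambda>B. D * B * D) (mat_inverse (1\<^sub>m N - F))"
    unfolding F' using mat_inverse_involution_conj[OF D DD minus_carrier_mat[OF F]] by simp
  have W': "noise_cov m n \<theta>' = W"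
    by (simp add: noise_cov_def W_def assms(5))
  \<comment> \<open>Off the diagonal both sides vanish; on it the two equal signs cancel.\<close>
  have DWD: "D * W * D = W"
  proof (rule eq_matI)
    fix i j assume "i < dim_row W" "j < dim_col W"
    then have ij: "i < N" "j < N" using W by auto
    have "W $$ (i, j) = 0" if "i \<noteq> j"
      using model ij that W by (auto simp: diagonal_mat_def W_def N_def)
    then show "(D * W * D) $$ (i, j) = W $$ (i, j)"
      using mat_diag_conj_index[OF W ij, of d] dd[of j]
      by (cases "i = j") (auto simp: D_def algebra_simps)
  qed (use D W in auto)
  define E where "E = entailed_cov m n \<theta>"
  \<comment> \<open>The condition \<open>sgn\<close> holds for two observed indices, where both
    signs are 1, and for \<open>i = j\<close>, where the sign is squared. These are the entries that
    the two claims concern; a covariance of two distinct latent variables may change sign.\<close>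
  have E: "entailed_cov m n \<theta>' $$ (i, j) = E $$ (i, j)"
    if ij: "i < N" "j < N" and sgn: "d i * d j = 1" for i j
  proof (cases "mat_inverse (1\<^sub>m N - F)")
    case None
    \<comment> \<open>Both models then use the same junk value \<open>the None\<close> for the inverse.\<close>
    with inv' show ?thesis
      by (simp add: E_def entailed_cov_def W' flip: W_def F_def N_def)
  next
    case (Some B)
    have B: "B \<in> carrier_mat N N"
      using mat_inverse(2)[OF minus_carrier_mat[OF F] Some] by simp
    have E_eq: "E = B\<^sup>T * W * B"
      using Some by (simp add: E_def entailed_cov_def flip: W_def F_def N_def)
    have "(D * B * D)\<^sup>T = D * B\<^sup>T * D"
      using D B by (simp add: transpose_mult[of _ N N _ N] DT assoc_mult_mat[of _ N N _ N _ N])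
    \<comment> \<open>Replacing \<open>W\<close> by \<open>D * W * D\<close> makes all three factors
      conjugates, so that \<open>involution_conj_mult\<close> merges them.\<close>
    then have "entailed_cov m n \<theta>' = (D * B\<^sup>T * D) * (D * W * D) * (D * B * D)"
      using inv' Some by (simp add: entailed_cov_def W' DWD flip: N_def)
    also have "\<dots> = D * E * D"
    proof -
      have "B\<^sup>T \<in> carrier_mat N N" "B\<^sup>T * W \<in> carrier_mat N N" using B W by auto
      then show ?thesis
        unfolding E_eq using B W by (simp only: involution_conj_mult[OF D DD])
    qed
    finally have "entailed_cov m n \<theta>' $$ (i, j) = d i * E $$ (i, j) * d j"
      using mat_diag_conj_index[of E N i j d] ij B W by (simp add: D_def E_eq)
    also have "\<dots> = (d i * d j) * E $$ (i, j)" by simp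
    finally show ?thesis using sgn by simp
  qed
  have "Sigma_X m n \<theta>' = Sigma_X m n \<theta>"
    by (rule eq_matI) (auto simp: Sigma_X_def E E_def[symmetric] N_def d_def)
  moreover have "Sigma_L m n \<theta>' $$ (i, i) = Sigma_L m n \<theta> $$ (i, i)" if "i < m" for i
    using that E[of i i] dd[of i] by (simp add: Sigma_L_def E_def N_def)
  ultimately show ?thesis by simp
qed

end
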